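(* Let $\alpha,\beta$ be fixed real numbers. For a positive integer $n$ put $$x=\alpha^2-1,\qquad y=\beta^2-1,\qquad z=(\alpha+\beta+2n)(\alpha+\beta+2n+2),$$ $$j(t)=zt^3+3(x-y)t^2+(4x+4y-z)t+(x-y).$$ Then for all sufficiently large $n$ (depending on $\alpha,\beta$) the convexity of the zeros of the Jacobi polynomial $P_n^{(\alpha,\beta)}$ on $(-1,1)$ changes in the following way (from left to right), the intervals of convexity being the subintervals into which the zeros of $j$ in $(-1,1)$ divide $(-1,1)$: 1. if $|\alpha|\le 1$ and $|\beta|\le 1$, then convex-concave (so $j$ has exactly one zero in $(-1,1)$); 2. if $|\alpha|\le 1$ and $|\beta|>1$, then concave-convex-concave (exactly two zeros of $j$ in $(-1,1)$); 3. if $|\alpha|>1$ and $|\beta|\le 1$, then convex-concave-convex (exactly two zeros of $j$ in $(-1,1)$); 4. if $|\alpha|>1$ and $|\beta|>1$, then concave-convex-concave-convex (exactly three zeros of $j$ in $(-1,1)$). Here, e.g., "convex-concave" means that the zeros of $P_n^{(\alpha,\beta)}$ are convex on the first (leftmost) subinterval and concave on the second.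
   Context: $P_n^{(\alpha,\beta)}$ is the Jacobi polynomial, defined for all real $\alpha,\beta$ by $$P_n^{(\alpha,\beta)}(t)=\sum_{s=0}^{n}\binom{n+\alpha}{n-s}\binom{n+\beta}{s}\left(\frac{t-1}{2}\right)^{s}\left(\frac{t+1}{2}\right)^{n-s};$$ it satisfies $(1-t^2)x''(t)+(\beta-\alpha-(\alpha+\beta+2)t)x'(t)+n(n+\alpha+\beta+1)x(t)=0$ (here $x(t)$ denotes the unknown function). The equation has normal form $y''+F(t)y=0$ (unknown function $y(t)$, with the same zeros in $(-1,1)$), where, with the constants $x,y,z$ of the claim, $F(t)=\frac{-zt^2-2(x-y)t-2x-2y+z}{4(t^2-1)^2}$ and $F'(t)=\frac{j(t)}{2(t^2-1)^3}$; the intervals of convexity are those determined by the roots of $j$ in $(-1,1)$. Convexity convention: the zeros of a function on an interval $(a,b)$, listed in increasing order as $x_1<x_2<\dots$ (only those lying in $(a,b)$), are called convex on $(a,b)$ if $x_{k+2}-x_{k+1}>x_{k+1}-x_k$ for every three consecutive zeros $x_k<x_{k+1}<x_{k+2}$ in $(a,b)$, and concave on $(a,b)$ if $x_{k+2}-x_{k+1}<x_{k+1}-x_k$ for every three consecutive zeros in $(a,b)$. *)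

theory Defs
  imports Complex_Main "HOL-Computational_Algebra.Polynomial"
begin

text \<open>The generalised binomial coefficients (\<^const>\<open>gbinomial\<close>) make the formula meaningful
  for arbitrary real parameters. The linear factors are \<open>(t - 1) / 2\<close> and \<open>(t + 1) / 2\<close>.\<close>

definition jacobi_poly :: "real \<Rightarrow> real \<Rightarrow> nat \<Rightarrow> real poly" where
  "jacobi_poly \<alpha> \<beta> n =
     (\<Sum>s\<le>n. smult (((real n + \<alpha>) gchoose (n - s)) * ((real n + \<beta>) gchoose s))
               ([:- 1 / 2, 1 / 2:] ^ s * [:1 / 2, 1 / 2:] ^ (n - s)))"

lemma poly_jacobi_poly:
  "poly (jacobi_poly \<alpha> \<beta> n) t =
     (\<Sum>s = 0..n. ((real n + \<alpha>) gchoose (n - s)) * ((real n + \<beta>) gchoose s) *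
        ((t - 1) / 2) ^ s * ((t + 1) / 2) ^ (n - s))"
  by (simp add: jacobi_poly_def poly_sum poly_power atLeast0AtMost
        diff_divide_distrib add_divide_distrib algebra_simps)

text \<open>If \<open>y'' + F y = 0\<close> is the normal form of the Jacobi differential equation, then
  \<open>F'(t) = j(t) / (2 (t\<^sup>2 - 1)\<^sup>3)\<close> for the following cubic \<open>j\<close>, so that its zeros in
  \<open>(-1, 1)\<close> separate the intervals of monotonicity of \<open>F\<close>.\<close>

definition jacobi_j :: "real \<Rightarrow> real \<Rightarrow> nat \<Rightarrow> real \<Rightarrow> real" where
  "jacobi_j \<alpha> \<beta> n t =
     (let x = \<alpha>\<^sup>2 - 1;
          y = \<beta>\<^sup>2 - 1;
          z = (\<alpha> + \<beta> + 2 * real n) * (\<alpha> + \<beta> + 2 * real n + 2)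
      in z * t ^ 3 + 3 * (x - y) * t\<^sup>2 + (4 * x + 4 * y - z) * t + (x - y))"

definition jacobi_j_zeros :: "real \<Rightarrow> real \<Rightarrow> nat \<Rightarrow> real set" where
  "jacobi_j_zeros \<alpha> \<beta> n = {t \<in> {-1<..<1}. jacobi_j \<alpha> \<beta> n t = 0}"

definition consecutive_zeros :: "(real \<Rightarrow> real) \<Rightarrow> real \<Rightarrow> real \<Rightarrow> bool" where
  "consecutive_zeros f u v \<longleftrightarrow> u < v \<and> f u = 0 \<and> f v = 0 \<and> (\<forall>t\<in>{u<..<v}. f t \<noteq> 0)"

text \<open>Since \<open>(a, b)\<close> is an interval, zeros that are consecutive among those lying in \<open>(a, b)\<close>
  are the same as consecutive zeros that lie in \<open>(a, b)\<close>. Both properties hold vacuously when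
  there are fewer than three zeros in the interval.\<close>

definition zeros_convex_on :: "(real \<Rightarrow> real) \<Rightarrow> real \<Rightarrow> real \<Rightarrow> bool" where
  "zeros_convex_on f a b \<longleftrightarrow>
     (\<forall>u\<in>{a<..<b}. \<forall>v\<in>{a<..<b}. \<forall>w\<in>{a<..<b}.
        consecutive_zeros f u v \<and> consecutive_zeros f v w \<longrightarrow> w - v > v - u)"

definition zeros_concave_on :: "(real \<Rightarrow> real) \<Rightarrow> real \<Rightarrow> real \<Rightarrow> bool" where
  "zeros_concave_on f a b \<longleftrightarrow>
     (\<forall>u\<in>{a<..<b}. \<forall>v\<in>{a<..<b}. \<forall>w\<in>{a<..<b}.
        consecutive_zeros f u v \<and> consecutive_zeros f v w \<longrightarrow> w - v < v - u)"

end

theory Submission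
  imports Defs
begin

text \<open>Multiplying \<open>P\<^sub>n\<close> by the positive weight \<open>(1 - t)\<^bsup>(\<alpha> + 1)/2\<^esup> (1 + t)\<^bsup>(\<beta> + 1)/2\<^esup>\<close> keeps its
  zeros in \<open>(-1, 1)\<close> and turns the Jacobi equation into \<open>y'' + F y = 0\<close> (lemma \<open>jacobi_nf'_deriv\<close>).
  Suppose \<open>F\<close> is decreasing on an interval, and reflect the solution \<open>y\<close> in one of its zeros \<open>v\<close>. Going
  to the left from \<open>v\<close> one then meets a larger coefficient than going to the right, hence faster
  oscillation, and by Sturm comparison the zero before \<open>v\<close> is closer to \<open>v\<close> than the zero after
  it: the zeros are convex. In the same way an increasing \<open>F\<close> makes them concave (theorems
  \<open>zeros_convex_on_if_decreasing\<close> and \<open>zeros_concave_on_if_increasing\<close>).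

  As \<open>F' = j / (2 (t\<^sup>2 - 1)\<^sup>3)\<close> has the sign of \<open>-j\<close> on \<open>(-1, 1)\<close>, what remains is the sign
  pattern of the cubic \<open>j = z t (t\<^sup>2 - 1) + 3 (x - y) t\<^sup>2 + 4 (x + y) t + (x - y)\<close> when \<open>z\<close>
  is large compared with \<open>x\<close> and \<open>y\<close>, as it is for large \<open>n\<close>. On \<open>[-1/2, 1/2]\<close> the first
  summand dominates the slope, and \<open>j\<close> falls from positive to negative values. On \<open>[1/2, 1]\<close> the cubic is convex and
  starts negative, so the sign of \<open>j(1) = 8 x\<close>, that is whether \<open>\<bar>\<alpha>\<bar> > 1\<close>, decides whether it
  crosses zero once more. The identity \<open>j\<^bsub>x,y\<^esub>(-t) = -j\<^bsub>y,x\<^esub>(t)\<close> transfers this to \<open>[-1, -1/2]\<close>,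
  with \<open>\<beta>\<close> in place of \<open>\<alpha>\<close>.\<close>

section \<open>Sturm comparison and the spacing of zeros\<close>

text \<open>The Wronskian \<open>W = g h' - g' h\<close> has derivative \<open>(G - H) g h < 0\<close> and vanishes at \<open>0\<close>, so
  \<open>W(L) < 0\<close>. But \<open>W(L) = - g'(L) h(L)\<close>, where \<open>g'(L) \<le> 0\<close> because \<open>g\<close> comes down to its zero
  \<open>L\<close> from positive values, and \<open>h(L) \<ge> 0\<close> by continuity.\<close>

lemma sturm_comparison_pos:
  fixes g g' G h h' H :: "real \<Rightarrow> real"
  assumes L: "0 < L"
    and g: "\<And>s. s \<in> {0..L} \<Longrightarrow> (g has_real_derivative g' s) (at s)"
    and g': "\<And>s. s \<in> {0..L} \<Longrightarrow> (g' has_real_derivative - (G s * g s)) (at s)"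
    and h: "\<And>s. s \<in> {0..L} \<Longrightarrow> (h has_real_derivative h' s) (at s)"
    and h': "\<And>s. s \<in> {0..L} \<Longrightarrow> (h' has_real_derivative - (H s * h s)) (at s)"
    and less: "\<And>s. s \<in> {0<..<L} \<Longrightarrow> G s < H s"
    and ends: "g 0 = 0" "h 0 = 0" "g L = 0"
    and gpos: "\<And>s. s \<in> {0<..<L} \<Longrightarrow> 0 < g s"
    and hpos: "\<And>s. s \<in> {0<..<L} \<Longrightarrow> 0 < h s"
  shows False
proof -
  define W where "W = (\<lambda>s. g s * h' s - g' s * h s)"
  have W': "(W has_real_derivative (G s - H s) * (g s * h s)) (at s)" if "s \<in> {0..L}" for s
    unfolding W_def using g[OF that] g'[OF that] h[OF that] h'[OF that]
    by (auto intro!: derivative_eq_intros simp: algebra_simps)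
  have "W L < W 0"
  proof (rule DERIV_neg_imp_decreasing_open[OF L])
    fix s assume s: "0 < s" "s < L"
    have "(G s - H s) * (g s * h s) < 0"
      using less[of s] gpos[of s] hpos[of s] s by (intro mult_neg_pos mult_pos_pos) auto
    then show "\<exists>y. (W has_real_derivative y) (at s) \<and> y < 0"
      using W'[of s] s by auto
  next
    show "continuous_on {0..L} W"
      by (rule DERIV_continuous_on) (blast intro: has_field_derivative_at_within W')
  qed
  moreover have "W 0 = 0" "W L = - (g' L * h L)"
    using ends by (auto simp: W_def)
  ultimately have neg: "0 < g' L * h L" by simp
  have "(h \<longlongrightarrow> h L) (at_left L)"
    using DERIV_isCont[OF h, of L] L by (auto simp: isCont_def intro: filterlim_mono at_le)
  moreover have "eventually (\<lambda>s. 0 \<le> h s) (at_left L)"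
    using eventually_at_left_real[OF L] by eventually_elim (use hpos in \<open>auto intro: less_imp_le\<close>)
  ultimately have "0 \<le> h L"
    by (intro tendsto_lowerbound) auto
  with neg have "0 < g' L"
    by (simp add: zero_less_mult_iff)
  then obtain d where d: "d > 0" "\<And>e. 0 < e \<Longrightarrow> e < d \<Longrightarrow> g (L - e) < g L"
    using DERIV_pos_inc_left[OF g, of L] L by auto
  have "g (L - min d L / 2) < 0" "0 < g (L - min d L / 2)"
    using d(2)[of "min d L / 2"] gpos[of "L - min d L / 2"] d(1) L ends by (auto simp: min_def split: if_splits)
  then show False by simp
qed

lemma nonzero_const_sign:
  fixes g :: "real \<Rightarrow> real"
  assumes "continuous_on {a<..<b} g" "\<And>s. s \<in> {a<..<b} \<Longrightarrow> g s \<noteq> 0"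
  obtains \<sigma> :: real where "\<And>s. s \<in> {a<..<b} \<Longrightarrow> 0 < \<sigma> * g s"
proof (cases "\<forall>s\<in>{a<..<b}. 0 < g s")
  case True
  then show ?thesis using that[of 1] by simp
next
  case False
  then obtain c where c: "c \<in> {a<..<b}" "g c < 0"
    using assms(2) by force
  have "g s < 0" if s: "s \<in> {a<..<b}" for s
  proof (rule ccontr)
    assume "\<not> g s < 0"
    moreover have "connected (g ` {a<..<b})"
      by (intro connected_continuous_image assms(1)) auto
    ultimately have "0 \<in> g ` {a<..<b}"
      using connectedD_interval[of "g ` {a<..<b}" "g c" "g s" 0] s c by auto
    then show False using assms(2) by auto
  qed
  then show ?thesis using that[of "-1"] by simp
qed

text \<open>The equation is linear, so \<open>g\<close> and \<open>h\<close> may be rescaled to be positive on \<open>(0, L)\<close>.\<close>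

theorem sturm_comparison:
  fixes g g' G h h' H :: "real \<Rightarrow> real"
  assumes L: "0 < L"
    and g: "\<And>s. s \<in> {0..L} \<Longrightarrow> (g has_real_derivative g' s) (at s)"
    and g': "\<And>s. s \<in> {0..L} \<Longrightarrow> (g' has_real_derivative - (G s * g s)) (at s)"
    and h: "\<And>s. s \<in> {0..L} \<Longrightarrow> (h has_real_derivative h' s) (at s)"
    and h': "\<And>s. s \<in> {0..L} \<Longrightarrow> (h' has_real_derivative - (H s * h s)) (at s)"
    and less: "\<And>s. s \<in> {0<..<L} \<Longrightarrow> G s < H s"
    and ends: "g 0 = 0" "h 0 = 0" "g L = 0"
    and nz: "\<And>s. s \<in> {0<..<L} \<Longrightarrow> g s \<noteq> 0"
  shows "\<exists>s\<in>{0<..<L}. h s = 0"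
proof (rule ccontr)
  assume "\<not> ?thesis"
  then have hnz: "\<And>s. s \<in> {0<..<L} \<Longrightarrow> h s \<noteq> 0" by blast
  have cont: "continuous_on {0<..<L} g" "continuous_on {0<..<L} h"
    by (rule DERIV_continuous_on, rule has_field_derivative_at_within, rule g h, simp)+
  obtain \<sigma> where \<sigma>: "\<And>s. s \<in> {0<..<L} \<Longrightarrow> 0 < \<sigma> * g s"
    using nonzero_const_sign[OF cont(1) nz] by blast
  obtain \<tau> where \<tau>: "\<And>s. s \<in> {0<..<L} \<Longrightarrow> 0 < \<tau> * h s"
    using nonzero_const_sign[OF cont(2) hnz] by blast
  show False
  proof (rule sturm_comparison_pos[of L "\<lambda>s. \<sigma> * g s" "\<lambda>s. \<sigma> * g' s" G
        "\<lambda>s. \<tau> * h s" "\<lambda>s. \<tau> * h' s" H])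
    fix s assume s: "s \<in> {0..L}"
    show "((\<lambda>s. \<sigma> * g s) has_real_derivative \<sigma> * g' s) (at s)"
         "((\<lambda>s. \<tau> * h s) has_real_derivative \<tau> * h' s) (at s)"
      using s by (intro DERIV_cmult g h; simp)+
    show "((\<lambda>s. \<sigma> * g' s) has_real_derivative - (G s * (\<sigma> * g s))) (at s)"
      using DERIV_cmult[OF g'[OF s], of \<sigma>] by (simp add: mult_ac)
    show "((\<lambda>s. \<tau> * h' s) has_real_derivative - (H s * (\<tau> * h s))) (at s)"
      using DERIV_cmult[OF h'[OF s], of \<tau>] by (simp add: mult_ac)
  qed (use L less ends \<sigma> \<tau> in auto)
qed

text \<open>The two functions compared here are the continuations of the same solution \<open>y\<close> to the two sides of
  its zero \<open>v\<close>. The sign \<open>c\<close> selects the side on which the zero at distance \<open>L\<close> is given; the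
  coefficient is larger on the other side, and so a zero is met there sooner.\<close>

lemma sturm_comparison_reflected:
  fixes y y' F :: "real \<Rightarrow> real"
  assumes y: "\<And>t. t \<in> {a<..<b} \<Longrightarrow> (y has_real_derivative y' t) (at t)"
    and y': "\<And>t. t \<in> {a<..<b} \<Longrightarrow> (y' has_real_derivative - (F t * y t)) (at t)"
    and c: "\<bar>c\<bar> = 1"
    and L: "0 < L" "a < v - L" "v + L < b"
    and less: "\<And>s. s \<in> {0<..<L} \<Longrightarrow> F (v + c * s) < F (v - c * s)"
    and zeros: "y v = 0" "y (v + c * L) = 0"
    and nz: "\<And>s. s \<in> {0<..<L} \<Longrightarrow> y (v + c * s) \<noteq> 0"
  shows "\<exists>s\<in>{0<..<L}. y (v - c * s) = 0"
proof -
  \<comment> \<open>The reflection \<open>s \<mapsto> v + k s\<close> with \<open>k\<^sup>2 = 1\<close> leaves the form of the equation unchanged.\<close>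
  have side: "((\<lambda>s. y (v + k * s)) has_real_derivative k * y' (v + k * s)) (at s)"
    "((\<lambda>s. k * y' (v + k * s)) has_real_derivative - (F (v + k * s) * y (v + k * s))) (at s)"
    if k: "k = 1 \<or> k = - 1" and s: "s \<in> {0..L}" for k s
  proof -
    have t: "v + k * s \<in> {a<..<b}" using k s L by auto
    have aff: "((\<lambda>s. v + k * s) has_real_derivative k) (at s)"
      by (auto intro!: derivative_eq_intros)
    show "((\<lambda>s. y (v + k * s)) has_real_derivative k * y' (v + k * s)) (at s)"
      using DERIV_chain2[OF y[OF t] aff] by (simp add: mult.commute)
    show "((\<lambda>s. k * y' (v + k * s)) has_real_derivative - (F (v + k * s) * y (v + k * s))) (at s)"
      using DERIV_cmult[OF DERIV_chain2[OF y'[OF t] aff], of k] k by auto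
  qed
  have c': "c = 1 \<or> c = - 1" "- c = 1 \<or> - c = - 1" using c by auto
  have "\<exists>s\<in>{0<..<L}. y (v + (- c) * s) = 0"
    by (rule sturm_comparison[OF L(1) side[OF c'(1)] side[OF c'(2)]])
      (use less zeros nz in auto)
  then show ?thesis by simp
qed

theorem zeros_convex_on_if_decreasing:
  fixes y y' F :: "real \<Rightarrow> real"
  assumes y: "\<And>t. t \<in> {a<..<b} \<Longrightarrow> (y has_real_derivative y' t) (at t)"
    and y': "\<And>t. t \<in> {a<..<b} \<Longrightarrow> (y' has_real_derivative - (F t * y t)) (at t)"
    and F: "\<And>s t. a < s \<Longrightarrow> s < t \<Longrightarrow> t < b \<Longrightarrow> F t < F s"
  shows "zeros_convex_on y a b"
  unfolding zeros_convex_on_def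
proof (intro ballI impI)
  fix u v w
  assume uvw: "u \<in> {a<..<b}" "v \<in> {a<..<b}" "w \<in> {a<..<b}"
    and z: "consecutive_zeros y u v \<and> consecutive_zeros y v w"
  show "v - u < w - v"
  proof (rule ccontr)
    assume "\<not> ?thesis"
    then have L: "w - v \<le> v - u" by simp
    have "\<exists>s\<in>{0<..<w - v}. y (v - 1 * s) = 0"
      by (rule sturm_comparison_reflected[OF y y'])
        (use uvw z L in \<open>auto simp: consecutive_zeros_def intro!: F\<close>)
    then show False using z L by (auto simp: consecutive_zeros_def)
  qed
qed

theorem zeros_concave_on_if_increasing:
  fixes y y' F :: "real \<Rightarrow> real"
  assumes y: "\<And>t. t \<in> {a<..<b} \<Longrightarrow> (y has_real_derivative y' t) (at t)"
    and y': "\<And>t. t \<in> {a<..<b} \<Longrightarrow> (y' has_real_derivative - (F t * y t)) (at t)"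
    and F: "\<And>s t. a < s \<Longrightarrow> s < t \<Longrightarrow> t < b \<Longrightarrow> F s < F t"
  shows "zeros_concave_on y a b"
  unfolding zeros_concave_on_def
proof (intro ballI impI)
  fix u v w
  assume uvw: "u \<in> {a<..<b}" "v \<in> {a<..<b}" "w \<in> {a<..<b}"
    and z: "consecutive_zeros y u v \<and> consecutive_zeros y v w"
  show "w - v < v - u"
  proof (rule ccontr)
    assume "\<not> ?thesis"
    then have L: "v - u \<le> w - v" by simp
    have "\<exists>s\<in>{0<..<v - u}. y (v - (- 1) * s) = 0"
      by (rule sturm_comparison_reflected[OF y y'])
        (use uvw z L in \<open>auto simp: consecutive_zeros_def intro!: F\<close>)
    then show False using z L by (auto simp: consecutive_zeros_def)
  qed
qed

section \<open>The Jacobi differential equation\<close>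

definition jacobi_basis :: "nat \<Rightarrow> nat \<Rightarrow> real poly" where
  "jacobi_basis n s = [:- 1 / 2, 1 / 2:] ^ s * [:1 / 2, 1 / 2:] ^ (n - s)"

definition jacobi_coeff :: "real \<Rightarrow> real \<Rightarrow> nat \<Rightarrow> nat \<Rightarrow> real" where
  "jacobi_coeff \<alpha> \<beta> n s = ((real n + \<alpha>) gchoose (n - s)) * ((real n + \<beta>) gchoose s)"

lemma jacobi_poly_expansion:
  "jacobi_poly \<alpha> \<beta> n = (\<Sum>s\<le>n. smult (jacobi_coeff \<alpha> \<beta> n s) (jacobi_basis n s))"
  by (simp add: jacobi_poly_def jacobi_coeff_def jacobi_basis_def)

text \<open>This recurrence is what makes the sum in \<open>jacobi_ode\<close> telescope.\<close>

lemma jacobi_coeff_Suc: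
  assumes "s < n"
  shows "jacobi_coeff \<alpha> \<beta> n (Suc s) * ((real s + 1) * (real s + 1 + \<alpha>)) =
    jacobi_coeff \<alpha> \<beta> n s * ((real n - real s) * (real n - real s + \<beta>))"
proof -
  obtain m where m: "n - s = Suc m" "n - Suc s = m" "real n = real s + real m + 1"
    using assms that[of "n - Suc s"] by (simp add: of_nat_diff Suc_diff_Suc)
  have "((real n + \<alpha>) gchoose Suc m) * (real m + 1) = ((real n + \<alpha>) gchoose m) * (real s + 1 + \<alpha>)"
    using gbinomial_absorb_comp[of "real n + \<alpha>" m] gbinomial_absorption[of m "real n + \<alpha>"] m(3)
    by (simp add: algebra_simps)
  moreover have "((real n + \<beta>) gchoose Suc s) * (real s + 1) =
      ((real n + \<beta>) gchoose s) * (real n - real s + \<beta>)"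
    using gbinomial_absorb_comp[of "real n + \<beta>" s] gbinomial_absorption[of s "real n + \<beta>"]
    by (simp add: algebra_simps)
  moreover have "real n - real s = real m + 1" using m(3) by simp
  ultimately show ?thesis
    unfolding jacobi_coeff_def m(1,2) by algebra
qed

text \<open>The left-hand side of the Jacobi equation, with \<open>p\<close> as the unknown function.\<close>

definition jacobi_op :: "real \<Rightarrow> real \<Rightarrow> nat \<Rightarrow> real poly \<Rightarrow> real \<Rightarrow> real" where
  "jacobi_op \<alpha> \<beta> n p t =
     (1 - t\<^sup>2) * poly (pderiv (pderiv p)) t + (\<beta> - \<alpha> - (\<alpha> + \<beta> + 2) * t) * poly (pderiv p) t
     + real n * (real n + \<alpha> + \<beta> + 1) * poly p t"

lemma jacobi_op_add: "jacobi_op \<alpha> \<beta> n (p + q) t = jacobi_op \<alpha> \<beta> n p t + jacobi_op \<alpha> \<beta> n q t"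
  and jacobi_op_smult: "jacobi_op \<alpha> \<beta> n (smult k p) t = k * jacobi_op \<alpha> \<beta> n p t"
  and jacobi_op_0: "jacobi_op \<alpha> \<beta> n 0 t = 0"
  by (simp_all add: jacobi_op_def pderiv_add pderiv_smult algebra_simps)

lemma jacobi_op_sum:
  "jacobi_op \<alpha> \<beta> n (\<Sum>s\<in>A. smult (c s) (f s)) t = (\<Sum>s\<in>A. c s * jacobi_op \<alpha> \<beta> n (f s) t)"
  by (induction A rule: infinite_finite_induct)
    (simp_all add: jacobi_op_0 jacobi_op_add jacobi_op_smult)

lemma pderiv_jacobi_monomial:
  defines "P \<equiv> [:- 1 / 2, 1 / 2:] :: real poly" and "Q \<equiv> [:1 / 2, 1 / 2:] :: real poly"
  shows "pderiv (P ^ i * Q ^ m) =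
    smult (real i / 2) (P ^ (i - 1) * Q ^ m) + smult (real m / 2) (P ^ i * Q ^ (m - 1))"
proof -
  have "pderiv P = [:1 / 2:]" "pderiv Q = [:1 / 2:]"
    by (simp_all add: P_def Q_def pderiv_pCons)
  then have "pderiv (P ^ k) = smult (real k / 2) (P ^ (k - 1))"
    "pderiv (Q ^ k) = smult (real k / 2) (Q ^ (k - 1))" for k
    by (simp_all add: pderiv_power)
  then show ?thesis
    by (simp add: pderiv_mult mult.commute)
qed

lemma poly_pderiv_jacobi_basis:
  fixes t :: real and s n
  defines "X \<equiv> (t - 1) / 2" and "Y \<equiv> (t + 1) / 2" and "m \<equiv> n - s"
  shows "poly (jacobi_basis n s) t = X ^ s * Y ^ m"
    and "poly (pderiv (jacobi_basis n s)) t =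
      (real s * X ^ (s - 1) * Y ^ m + real m * X ^ s * Y ^ (m - 1)) / 2"
    and "poly (pderiv (pderiv (jacobi_basis n s))) t =
      (real s * real (s - 1) * X ^ (s - 2) * Y ^ m + 2 * (real s * real m * X ^ (s - 1) * Y ^ (m - 1))
        + real m * real (m - 1) * X ^ s * Y ^ (m - 2)) / 4"
proof -
  have X: "poly [:- 1 / 2, 1 / 2:] t = X" and Y: "poly [:1 / 2, 1 / 2:] t = Y"
    by (simp_all add: X_def Y_def field_simps)
  have ring: "a / 2 * (a' / 2 * (u2 * v0) + b / 2 * (u1 * v1)) + b / 2 * (a / 2 * (u1 * v1) + b' / 2 * (u0 * v2))
      = (a * a' * u2 * v0 + 2 * (a * b * u1 * v1) + b * b' * u0 * v2) / 4"
    for a a' b b' u0 u1 u2 v0 v1 v2 :: real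
    by (simp add: field_simps)
  have two: "k - 1 - 1 = k - 2" for k :: nat by simp
  show "poly (jacobi_basis n s) t = X ^ s * Y ^ m"
    unfolding jacobi_basis_def poly_mult poly_power X Y m_def ..
  show "poly (pderiv (jacobi_basis n s)) t =
      (real s * X ^ (s - 1) * Y ^ m + real m * X ^ s * Y ^ (m - 1)) / 2"
    unfolding jacobi_basis_def pderiv_jacobi_monomial poly_add poly_smult poly_mult poly_power X Y
      m_def[symmetric]
    by (simp only: add_divide_distrib times_divide_eq_left mult.assoc)
  show "poly (pderiv (pderiv (jacobi_basis n s))) t =
      (real s * real (s - 1) * X ^ (s - 2) * Y ^ m + 2 * (real s * real m * X ^ (s - 1) * Y ^ (m - 1))
        + real m * real (m - 1) * X ^ s * Y ^ (m - 2)) / 4"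
    unfolding jacobi_basis_def pderiv_jacobi_monomial pderiv_add pderiv_smult
      poly_add poly_smult poly_mult poly_power X Y two m_def[symmetric]
    by (rule ring)
qed

text \<open>With \<open>X = (t - 1)/2\<close>, \<open>Y = (t + 1)/2\<close> and \<open>m = n - s\<close>, the operator sends the basis element
  \<open>T\<^sub>s = X\<^sup>s Y\<^sup>m\<close> to a combination of \<open>T\<^bsub>s-1\<^esub>\<close>, \<open>T\<^sub>s\<close>, \<open>T\<^bsub>s+1\<^esub>\<close> of the form
  \<open>m (m + \<beta>) (T\<^sub>s - T\<^bsub>s+1\<^esub>) - s (s + \<alpha>) (T\<^bsub>s-1\<^esub> - T\<^sub>s)\<close>. Since \<open>Y - X = 1\<close>, the differences
  are single monomials of degree \<open>n - 1\<close>. The boundary cases, where an exponent on the right is a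
  truncated subtraction, carry the coefficient \<open>0\<close>.\<close>

lemma jacobi_op_basis:
  fixes t :: real
  defines "X \<equiv> (t - 1) / 2" and "Y \<equiv> (t + 1) / 2"
  assumes "s \<le> n"
  shows "jacobi_op \<alpha> \<beta> n (jacobi_basis n s) t =
    (real n - real s) * (real n - real s + \<beta>) * (X ^ s * Y ^ (n - Suc s))
    - real s * (real s + \<alpha>) * (X ^ (s - 1) * Y ^ (n - s))"
proof -
  define m where "m = n - s"
  have n: "real n = real s + real m" using assms by (simp add: m_def)
  have Y: "Y = X + 1" and t: "t = 2 * X + 1" by (simp_all add: X_def Y_def field_simps)
  define p where "p = real s * X ^ (s - 1)"
  define q where "q = real m * Y ^ (m - 1)"
  define p2 where "p2 = real s * real (s - 1) * X ^ (s - 2)"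
  define q2 where "q2 = real m * real (m - 1) * Y ^ (m - 2)"
  define A where "A = X ^ s"
  define B where "B = Y ^ m"
  \<comment> \<open>These rules lower the factors coming from derivatives back to \<open>X\<^sup>s\<close> and \<open>Y\<^sup>m\<close>; written as
    products they hold for small exponents as well, so that the rest is pure ring algebra.\<close>
  have pX: "p * X = real s * A" and qY: "q * Y = real m * B"
    unfolding p_def q_def A_def B_def by (cases s; cases m; simp)+
  have p2X: "p2 * X = (real s - 1) * p" and q2Y: "q2 * Y = (real m - 1) * q"
    unfolding p2_def q2_def p_def q_def
    by (cases s; cases "s - 1"; simp) (cases m; cases "m - 1"; simp)
  have d0: "poly (jacobi_basis n s) t = A * B"
    and d1: "poly (pderiv (jacobi_basis n s)) t = (p * B + q * A) / 2"
    and d2: "poly (pderiv (pderiv (jacobi_basis n s))) t = (p2 * B + 2 * (p * q) + q2 * A) / 4"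
    using poly_pderiv_jacobi_basis[of n s t, folded X_def Y_def m_def]
    by (simp_all add: p_def q_def p2_def q2_def A_def B_def mult_ac)
  have "jacobi_op \<alpha> \<beta> n (jacobi_basis n s) t =
    - (X * Y * (p2 * B + 2 * (p * q) + q2 * A))
    - ((\<alpha> + 1) * Y + (\<beta> + 1) * X) * (p * B + q * A)
    + real n * (real n + \<alpha> + \<beta> + 1) * (A * B)"
    unfolding jacobi_op_def d0 d1 d2 unfolding t Y by (simp add: field_simps power2_eq_square)
  also have "X * Y * (p2 * B + 2 * (p * q) + q2 * A) =
      (p2 * X) * Y * B + 2 * (p * X) * (q * Y) + (q2 * Y) * X * A" by algebra
  also have "\<dots> = (real s - 1) * p * Y * B + 2 * (real s * A) * (real m * B) + (real m - 1) * q * X * A"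
    unfolding p2X q2Y pX qY ..
  also have "- \<dots> - ((\<alpha> + 1) * Y + (\<beta> + 1) * X) * (p * B + q * A)
    + real n * (real n + \<alpha> + \<beta> + 1) * (A * B) =
     (real m + \<beta>) * q * A - (real s + \<alpha>) * p * B"
    using pX qY unfolding n Y by algebra
  finally show ?thesis
    unfolding n p_def q_def A_def B_def m_def by (simp add: mult_ac)
qed

text \<open>Applied termwise to the defining sum, the first part of the image of \<open>T\<^sub>s\<close> cancels the second
  part of the image of \<open>T\<^bsub>s+1\<^esub>\<close>.\<close>

theorem jacobi_ode: "jacobi_op \<alpha> \<beta> n (jacobi_poly \<alpha> \<beta> n) t = 0"
proof -
  define X where "X = (t - 1) / 2"
  define Y where "Y = (t + 1) / 2"
  define c where "c = jacobi_coeff \<alpha> \<beta> n"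
  define f where "f s = c s * (real s * (real s + \<alpha>)) * (X ^ (s - 1) * Y ^ (n - s))" for s
  have term_eq: "c s * jacobi_op \<alpha> \<beta> n (jacobi_basis n s) t =
      c s * ((real n - real s) * (real n - real s + \<beta>)) * (X ^ s * Y ^ (n - Suc s)) - f s"
    if "s \<le> n" for s
    unfolding jacobi_op_basis[OF that] f_def X_def[symmetric] Y_def[symmetric]
    by (simp only: right_diff_distrib mult.assoc)
  have step: "c s * ((real n - real s) * (real n - real s + \<beta>)) * (X ^ s * Y ^ (n - Suc s)) = f (Suc s)"
    if "s < n" for s
    using jacobi_coeff_Suc[OF that, of \<alpha> \<beta>] unfolding f_def c_def
    by (simp add: add.commute)
  have "jacobi_op \<alpha> \<beta> n (jacobi_poly \<alpha> \<beta> n) t = (\<Sum>s\<le>n. c s * jacobi_op \<alpha> \<beta> n (jacobi_basis n s) t)"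
    unfolding jacobi_poly_expansion jacobi_op_sum c_def ..
  \<comment> \<open>The term \<open>s = n\<close> is split off: there the first part vanishes because of the factor \<open>n - s\<close>,
    and no coefficient with index \<open>n + 1\<close> enters.\<close>
  also have "\<dots> = (\<Sum>s<n. c s * jacobi_op \<alpha> \<beta> n (jacobi_basis n s) t) + c n * jacobi_op \<alpha> \<beta> n (jacobi_basis n n) t"
    by (simp add: lessThan_Suc_atMost[symmetric])
  also have "(\<Sum>s<n. c s * jacobi_op \<alpha> \<beta> n (jacobi_basis n s) t) = (\<Sum>s<n. f (Suc s) - f s)"
    by (intro sum.cong refl) (simp add: term_eq step)
  also have "\<dots> = f n - f 0"
    by (rule sum_lessThan_telescope)
  also have "c n * jacobi_op \<alpha> \<beta> n (jacobi_basis n n) t = - f n"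
    by (simp add: term_eq)
  finally show ?thesis by (simp add: f_def)
qed

section \<open>The sign pattern of the cubic for large leading coefficient\<close>

definition jcubic :: "real \<Rightarrow> real \<Rightarrow> real \<Rightarrow> real \<Rightarrow> real" where
  "jcubic x y z t = z * t ^ 3 + 3 * (x - y) * t\<^sup>2 + (4 * x + 4 * y - z) * t + (x - y)"

lemma jcubic_reflect: "jcubic x y z (- t) = - jcubic y x z t"
  by (simp add: jcubic_def algebra_simps power2_eq_square power3_eq_cube)

text \<open>The factor \<open>z (a + b + c) + 3 (x - y)\<close> is the second divided difference of the cubic. Its sign
  expresses convexity without derivatives.\<close>

lemma jcubic_second_difference:
  "(c - b) * jcubic x y z a + (b - a) * jcubic x y z c - (c - a) * jcubic x y z b =
     (c - b) * (b - a) * (c - a) * (z * (a + b + c) + 3 * (x - y))"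
  unfolding jcubic_def by algebra

lemma continuous_on_jcubic: "continuous_on A (jcubic x y z)"
  unfolding jcubic_def by (intro continuous_intros)

text \<open>The bound on \<open>z\<close> is not sharp. The largest factor called for is \<open>28\<close>, for the monotonicity on
  \<open>[-1/2, 1/2]\<close>, where \<open>z/4\<close> has to exceed \<open>3 \<bar>x - y\<bar> + 4 \<bar>x + y\<bar>\<close>; the additive constant keeps \<open>z\<close>
  positive when \<open>x = y = 0\<close>.\<close>

context
  fixes x y z :: real
  assumes z_large: "z > 40 * (\<bar>x\<bar> + \<bar>y\<bar>) + 40"
begin

lemma jcubic_at_half: "jcubic x y z (1/2) < 0"
  using z_large by (simp add: jcubic_def power2_eq_square power3_eq_cube) argo

lemma jcubic_below_chord:
  assumes "1/2 \<le> a" "a < b" "b < c"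
  shows "(c - a) * jcubic x y z b < (c - b) * jcubic x y z a + (b - a) * jcubic x y z c"
proof -
  have "z * 1 \<le> z * (a + b + c)"
    using assms z_large by (intro mult_left_mono) auto
  then have "0 < z * (a + b + c) + 3 * (x - y)"
    using z_large by argo
  then have "0 < (c - b) * (b - a) * (c - a) * (z * (a + b + c) + 3 * (x - y))"
    using assms by (intro mult_pos_pos) auto
  then show ?thesis unfolding jcubic_second_difference[symmetric] by simp
qed

text \<open>The difference quotient of \<open>t\<^sup>3 - t\<close> is \<open>a\<^sup>2 + a b + b\<^sup>2 - 1\<close>, which is at most \<open>-1/4\<close> for
  \<open>a, b \<in> [-1/2, 1/2]\<close>. For large \<open>z\<close> this outweighs the quotients of the other terms.\<close>

lemma jcubic_decreasing_middle:
  assumes "-1/2 \<le> a" "a < b" "b \<le> 1/2"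
  shows "jcubic x y z b < jcubic x y z a"
proof -
  have sq: "a\<^sup>2 \<le> (1/2)\<^sup>2" "b\<^sup>2 \<le> (1/2)\<^sup>2"
    using assms by (auto intro!: abs_le_square_iff[THEN iffD1])
  have "a * b \<le> (a\<^sup>2 + b\<^sup>2) / 2"
    using sum_squares_bound[of a b] by simp
  with sq have "a\<^sup>2 + a * b + b\<^sup>2 - 1 \<le> - 1/4" by (simp add: power2_eq_square)
  then have "z * (a\<^sup>2 + a * b + b\<^sup>2 - 1) \<le> z * (- 1/4)"
    using z_large by (intro mult_left_mono) auto
  moreover have "(x - y) * (a + b) \<le> \<bar>x - y\<bar> * 1"
  proof -
    have "(x - y) * (a + b) \<le> \<bar>(x - y) * (a + b)\<bar>" by simp
    also have "\<dots> \<le> \<bar>x - y\<bar> * 1"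
      unfolding abs_mult using assms by (intro mult_left_mono) auto
    finally show ?thesis .
  qed
  ultimately have "z * (a\<^sup>2 + a * b + b\<^sup>2 - 1) + 3 * ((x - y) * (a + b)) + 4 * (x + y) < 0"
    using z_large by argo
  then have "(b - a) * (z * (a\<^sup>2 + a * b + b\<^sup>2 - 1) + 3 * ((x - y) * (a + b)) + 4 * (x + y)) < 0"
    using assms by (intro mult_pos_neg) auto
  moreover have "(b - a) * (z * (a\<^sup>2 + a * b + b\<^sup>2 - 1) + 3 * ((x - y) * (a + b)) + 4 * (x + y)) =
      jcubic x y z b - jcubic x y z a"
    unfolding jcubic_def by algebra
  ultimately show ?thesis by simp
qed

text \<open>Here the chord over \<open>[1/2, 1]\<close> starts at a negative value and ends at \<open>8 x \<le> 0\<close>. In the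
  borderline case \<open>x = 0\<close> the cubic vanishes at \<open>1\<close>, hence the half-open range of \<open>t\<close>.\<close>

lemma jcubic_right_nonpos:
  assumes "x \<le> 0" "1/2 \<le> t" "t < 1"
  shows "jcubic x y z t < 0"
proof (cases "t = 1/2")
  case True
  show ?thesis unfolding True by (rule jcubic_at_half)
next
  case False
  have "(1 - 1/2) * jcubic x y z t < (1 - t) * jcubic x y z (1/2) + (t - 1/2) * jcubic x y z 1"
    using False assms by (intro jcubic_below_chord) auto
  moreover have "(1 - t) * jcubic x y z (1/2) \<le> 0" "(t - 1/2) * jcubic x y z 1 \<le> 0"
    using assms jcubic_at_half by (auto simp: jcubic_def mult_le_0_iff)
  ultimately show ?thesis by simp
qed

text \<open>A zero \<open>r\<close> exists since the cubic is negative at \<open>1/2\<close> and equals \<open>8 x > 0\<close> at \<open>1\<close>. The chord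
  over \<open>[1/2, r]\<close> is negative before \<open>r\<close>; and if the cubic were not positive at some \<open>t > r\<close>, the
  chord over \<open>[1/2, t]\<close> would force a negative value at \<open>r\<close>.\<close>

lemma jcubic_right_pos:
  assumes "0 < x"
  obtains r where "1/2 < r" "r < 1" "jcubic x y z r = 0"
    "\<And>t. 1/2 \<le> t \<Longrightarrow> t < r \<Longrightarrow> jcubic x y z t < 0"
    "\<And>t. r < t \<Longrightarrow> t < 1 \<Longrightarrow> 0 < jcubic x y z t"
proof -
  have j1: "0 < jcubic x y z 1" using assms by (simp add: jcubic_def)
  obtain r where r: "1/2 \<le> r" "r \<le> 1" "jcubic x y z r = 0"
    using IVT'[of "jcubic x y z" "1/2" 0 1] j1 jcubic_at_half continuous_on_jcubic
    by auto
  have r': "1/2 < r" "r < 1"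
    using r j1 jcubic_at_half by (metis order_le_less less_irrefl)+
  show ?thesis
  proof (rule that[OF r' r(3)])
    fix t assume t: "1/2 \<le> t" "t < r"
    show "jcubic x y z t < 0"
    proof (cases "t = 1/2")
      case False
      have "(r - 1/2) * jcubic x y z t < (r - t) * jcubic x y z (1/2) + (t - 1/2) * jcubic x y z r"
        using False t r by (intro jcubic_below_chord) auto
      moreover have "(r - t) * jcubic x y z (1/2) \<le> 0"
        using t jcubic_at_half by (auto simp: mult_le_0_iff)
      ultimately have "(r - 1/2) * jcubic x y z t < 0" using r by simp
      then show ?thesis using r' by (simp add: mult_less_0_iff)
    qed (metis jcubic_at_half)
  next
    fix t assume t: "r < t" "t < 1"
    have "(t - 1/2) * jcubic x y z r < (t - r) * jcubic x y z (1/2) + (r - 1/2) * jcubic x y z t"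
      using t r' by (intro jcubic_below_chord) auto
    moreover have "(t - r) * jcubic x y z (1/2) \<le> 0"
      using t jcubic_at_half by (auto simp: mult_le_0_iff)
    ultimately have "0 < (r - 1/2) * jcubic x y z t" using r by simp
    then show "0 < jcubic x y z t" using r' by (simp add: zero_less_mult_iff)
  qed
qed

end

lemma jcubic_left_nonpos:
  assumes "z > 40 * (\<bar>x\<bar> + \<bar>y\<bar>) + 40" "y \<le> 0" "-1 < t" "t \<le> -1/2"
  shows "0 < jcubic x y z t"
  using jcubic_right_nonpos[of y x z "-t"] assms jcubic_reflect[of y x z t] by simp

lemma jcubic_left_pos:
  assumes "z > 40 * (\<bar>x\<bar> + \<bar>y\<bar>) + 40" "0 < y"
  obtains r where "-1 < r" "r < -1/2" "jcubic x y z r = 0"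
    "\<And>t. -1 < t \<Longrightarrow> t < r \<Longrightarrow> jcubic x y z t < 0"
    "\<And>t. r < t \<Longrightarrow> t \<le> -1/2 \<Longrightarrow> 0 < jcubic x y z t"
proof -
  obtain r where r: "1/2 < r" "r < 1" "jcubic y x z r = 0"
    "\<And>t. 1/2 \<le> t \<Longrightarrow> t < r \<Longrightarrow> jcubic y x z t < 0"
    "\<And>t. r < t \<Longrightarrow> t < 1 \<Longrightarrow> 0 < jcubic y x z t"
    using jcubic_right_pos[of y x z] assms by (auto simp: add.commute)
  show ?thesis
  proof (rule that[of "- r"])
    fix t
    show "jcubic x y z t < 0" if "-1 < t" "t < - r"
      using r(5)[of "- t"] that jcubic_reflect[of y x z t] by simp
    show "0 < jcubic x y z t" if "- r < t" "t \<le> -1/2"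
      using r(4)[of "- t"] that jcubic_reflect[of y x z t] by simp
  qed (use r jcubic_reflect[of x y z r] in auto)
qed

lemma jcubic_middle:
  assumes z: "z > 40 * (\<bar>x\<bar> + \<bar>y\<bar>) + 40"
  obtains r where "-1/2 < r" "r < 1/2" "jcubic x y z r = 0"
    "\<And>t. -1/2 \<le> t \<Longrightarrow> t < r \<Longrightarrow> 0 < jcubic x y z t"
    "\<And>t. r < t \<Longrightarrow> t \<le> 1/2 \<Longrightarrow> jcubic x y z t < 0"
proof -
  have e: "jcubic x y z (1/2) < 0" "0 < jcubic x y z (-1/2)"
    using jcubic_at_half[of x y z] jcubic_at_half[of y x z] z jcubic_reflect[of x y z "1/2"] 
    by auto
  obtain r where r: "-1/2 \<le> r" "r \<le> 1/2" "jcubic x y z r = 0"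
    using IVT2'[of "jcubic x y z" "1/2" 0 "-1/2"] e continuous_on_jcubic by auto
  have r': "-1/2 < r" "r < 1/2"
    using r e by (metis order_le_less less_irrefl)+
  show ?thesis
    by (rule that[OF r' r(3)]) (use jcubic_decreasing_middle[OF z] r r' in fastforce)+
qed

section \<open>The normal form of the Jacobi equation\<close>

definition jacobi_z :: "real \<Rightarrow> real \<Rightarrow> nat \<Rightarrow> real" where
  "jacobi_z \<alpha> \<beta> n = (\<alpha> + \<beta> + 2 * real n) * (\<alpha> + \<beta> + 2 * real n + 2)"

lemma jacobi_j_eq_jcubic: "jacobi_j \<alpha> \<beta> n = jcubic (\<alpha>\<^sup>2 - 1) (\<beta>\<^sup>2 - 1) (jacobi_z \<alpha> \<beta> n)"
  by (simp add: fun_eq_iff jacobi_j_def jcubic_def jacobi_z_def Let_def)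

text \<open>The coefficient \<open>F\<close> of the normal form \<open>y'' + F y = 0\<close>.\<close>

definition jacobi_F :: "real \<Rightarrow> real \<Rightarrow> nat \<Rightarrow> real \<Rightarrow> real" where
  "jacobi_F \<alpha> \<beta> n t =
     (let x = \<alpha>\<^sup>2 - 1; y = \<beta>\<^sup>2 - 1; z = jacobi_z \<alpha> \<beta> n
      in (- z * t\<^sup>2 - 2 * (x - y) * t - 2 * x - 2 * y + z) / (4 * (t\<^sup>2 - 1)\<^sup>2))"

lemma jacobi_F_deriv:
  assumes "t \<in> {-1<..<1}"
  shows "(jacobi_F \<alpha> \<beta> n has_real_derivative jacobi_j \<alpha> \<beta> n t / (2 * (t\<^sup>2 - 1) ^ 3)) (at t)"
proof -
  have nz: "t\<^sup>2 - 1 \<noteq> 0"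
    using assms abs_square_less_1[of t] by auto
  define x where "x = \<alpha>\<^sup>2 - 1"
  define y where "y = \<beta>\<^sup>2 - 1"
  define z where "z = jacobi_z \<alpha> \<beta> n"
  define N where "N = (\<lambda>t. - z * t\<^sup>2 - 2 * (x - y) * t - 2 * x - 2 * y + z)"
  define D where "D = t\<^sup>2 - 1"
  have F: "jacobi_F \<alpha> \<beta> n = (\<lambda>t. N t / (4 * (t\<^sup>2 - 1)\<^sup>2))"
    by (simp add: fun_eq_iff jacobi_F_def Let_def N_def x_def y_def z_def)
  have N: "(N has_real_derivative - 2 * z * t - 2 * (x - y)) (at t)"
    unfolding N_def by (auto intro!: derivative_eq_intros)
  have Q: "((\<lambda>t. 4 * (t\<^sup>2 - 1)\<^sup>2) has_real_derivative 16 * t * D) (at t)"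
    by (auto intro!: derivative_eq_intros simp: D_def)
  have cancel: "(p * (4 * d\<^sup>2) - q * (16 * u * d)) / (4 * d\<^sup>2 * (4 * d\<^sup>2)) = (p * d - q * (4 * u)) / (4 * d ^ 3)"
    if "d \<noteq> 0" for p q u d :: real
  proof (subst frac_eq_eq)
    show "(p * (4 * d\<^sup>2) - q * (16 * u * d)) * (4 * d ^ 3) = (p * d - q * (4 * u)) * (4 * d\<^sup>2 * (4 * d\<^sup>2))"
      by algebra
  qed (use that in simp_all)
  have "(jacobi_F \<alpha> \<beta> n has_real_derivative
      ((- 2 * z * t - 2 * (x - y)) * (4 * D\<^sup>2) - N t * (16 * t * D)) / (4 * D\<^sup>2 * (4 * D\<^sup>2))) (at t)"
    using DERIV_divide[OF N Q] nz unfolding F D_def by simp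
  also have "((- 2 * z * t - 2 * (x - y)) * (4 * D\<^sup>2) - N t * (16 * t * D)) / (4 * D\<^sup>2 * (4 * D\<^sup>2)) =
      ((- 2 * z * t - 2 * (x - y)) * D - N t * (4 * t)) / (4 * D ^ 3)"
    using nz by (intro cancel) (simp add: D_def)
  also have "(- 2 * z * t - 2 * (x - y)) * D - N t * (4 * t) = 2 * jacobi_j \<alpha> \<beta> n t"
    unfolding jacobi_j_eq_jcubic jcubic_def N_def D_def x_def[symmetric] y_def[symmetric] z_def[symmetric]
    by algebra
  finally show ?thesis by (simp add: D_def)
qed

text \<open>The weight \<open>(1 - t)\<^bsup>(\<alpha> + 1)/2\<^esup> (1 + t)\<^bsup>(\<beta> + 1)/2\<^esup>\<close> on \<open>(-1, 1)\<close>, in a form that continues it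
  to a positive function on the whole line, so that multiplication by it changes no zeros.\<close>

definition jacobi_weight :: "real \<Rightarrow> real \<Rightarrow> real \<Rightarrow> real" where
  "jacobi_weight \<alpha> \<beta> t = exp ((\<alpha> + 1) / 2 * ln (1 - t) + (\<beta> + 1) / 2 * ln (1 + t))"

definition jacobi_nf :: "real \<Rightarrow> real \<Rightarrow> nat \<Rightarrow> real \<Rightarrow> real" where
  "jacobi_nf \<alpha> \<beta> n t = jacobi_weight \<alpha> \<beta> t * poly (jacobi_poly \<alpha> \<beta> n) t"

definition jacobi_nf' :: "real \<Rightarrow> real \<Rightarrow> nat \<Rightarrow> real \<Rightarrow> real" where
  "jacobi_nf' \<alpha> \<beta> n t = jacobi_weight \<alpha> \<beta> t *
     (poly (pderiv (jacobi_poly \<alpha> \<beta> n)) t +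
      ((\<beta> + 1) / 2 / (1 + t) - (\<alpha> + 1) / 2 / (1 - t)) * poly (jacobi_poly \<alpha> \<beta> n) t)"

lemma jacobi_weight_deriv:
  assumes "t \<in> {-1<..<1}"
  shows "(jacobi_weight \<alpha> \<beta> has_real_derivative
    jacobi_weight \<alpha> \<beta> t * ((\<beta> + 1) / 2 / (1 + t) - (\<alpha> + 1) / 2 / (1 - t))) (at t)"
proof -
  have "((\<lambda>t. a * ln (1 - t) + b * ln (1 + t)) has_real_derivative b / (1 + t) - a / (1 - t)) (at t)"
    for a b :: real
    using assms by (auto intro!: derivative_eq_intros simp: divide_inverse)
  from DERIV_fun_exp[OF this] show ?thesis
    unfolding jacobi_weight_def .
qed

lemma jacobi_nf_deriv:
  assumes "t \<in> {-1<..<1}"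
  shows "(jacobi_nf \<alpha> \<beta> n has_real_derivative jacobi_nf' \<alpha> \<beta> n t) (at t)"
  unfolding jacobi_nf_def jacobi_nf'_def
  by (rule DERIV_cong[OF DERIV_mult[OF jacobi_weight_deriv[OF assms] poly_DERIV]])
    (simp only: distrib_left mult_ac add_ac)

text \<open>Let \<open>m\<close> be the logarithmic derivative of the weight. Then \<open>2 m (1 - t\<^sup>2)\<close> is the coefficient of
  \<open>p'\<close> in the Jacobi equation, so that in \<open>(w p)'' = w (p'' + 2 m p' + (m' + m\<^sup>2) p)\<close> the
  derivatives of \<open>p\<close> can be eliminated.\<close>

lemma jacobi_nf'_deriv:
  assumes t: "t \<in> {-1<..<1}"
  shows "(jacobi_nf' \<alpha> \<beta> n has_real_derivative - (jacobi_F \<alpha> \<beta> n t * jacobi_nf \<alpha> \<beta> n t)) (at t)"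
proof -
  define P where "P = poly (jacobi_poly \<alpha> \<beta> n) t"
  define P1 where "P1 = poly (pderiv (jacobi_poly \<alpha> \<beta> n)) t"
  define P2 where "P2 = poly (pderiv (pderiv (jacobi_poly \<alpha> \<beta> n))) t"
  define W where "W = jacobi_weight \<alpha> \<beta> t"
  define a where "a = (\<alpha> + 1) / 2"
  define b where "b = (\<beta> + 1) / 2"
  define m where "m = b / (1 + t) - a / (1 - t)"
  define m' where "m' = - b / (1 + t)\<^sup>2 - a / (1 - t)\<^sup>2"
  define N where "N = real n * (real n + \<alpha> + \<beta> + 1)"
  have nz: "1 - t \<noteq> 0" "1 + t \<noteq> 0" using t by auto
  have "((\<lambda>t. b / (1 + t) - a / (1 - t)) has_real_derivative m') (at t)"
  proof (rule DERIV_cong[OF DERIV_diff[OF DERIV_divide[OF DERIV_const] DERIV_divide[OF DERIV_const]]])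
    show "((\<lambda>t. 1 + t) has_real_derivative 1) (at t)" "((\<lambda>t. 1 - t) has_real_derivative - 1) (at t)"
      by (auto intro!: derivative_eq_intros)
  qed (use nz in \<open>simp_all add: m'_def power2_eq_square\<close>)
  note DERIV_mult[OF jacobi_weight_deriv[OF t]
      DERIV_add[OF poly_DERIV DERIV_mult[OF this[unfolded a_def b_def] poly_DERIV]],
      of \<alpha> \<beta> "pderiv (jacobi_poly \<alpha> \<beta> n)" "jacobi_poly \<alpha> \<beta> n"]
  then have "(jacobi_nf' \<alpha> \<beta> n has_real_derivative
      W * m * (P1 + m * P) + (P2 + (m' * P + P1 * m)) * W) (at t)"
    unfolding jacobi_nf'_def m_def W_def P_def P1_def P2_def a_def b_def .
  also have "W * m * (P1 + m * P) + (P2 + (m' * P + P1 * m)) * W = W * ((P2 + 2 * m * P1) + (m' + m\<^sup>2) * P)"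
    by algebra
  also have "P2 + 2 * m * P1 = - (N / ((1 - t) * (1 + t))) * P"
  proof -
    have ode: "(1 - t\<^sup>2) * P2 + (\<beta> - \<alpha> - (\<alpha> + \<beta> + 2) * t) * P1 + N * P = 0"
      using jacobi_ode[of \<alpha> \<beta> n t] unfolding jacobi_op_def P_def P1_def P2_def N_def .
    have "2 * m * ((1 - t) * (1 + t)) = \<beta> - \<alpha> - (\<alpha> + \<beta> + 2) * t"
      using nz unfolding m_def a_def b_def by (simp add: divide_simps) algebra
    with ode have "(P2 + 2 * m * P1) * ((1 - t) * (1 + t)) = - N * P" by algebra
    then show ?thesis using nz by (simp add: divide_simps)
  qed
  also have "m' + m\<^sup>2 = N / ((1 - t) * (1 + t)) - jacobi_F \<alpha> \<beta> n t"
  proof -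
    have D: "(t\<^sup>2 - 1)\<^sup>2 = (1 - t)\<^sup>2 * (1 + t)\<^sup>2" by algebra
    have "4 * (m' + m\<^sup>2) * ((1 - t)\<^sup>2 * (1 + t)\<^sup>2) =
       4 * (- b * (1 - t)\<^sup>2 - a * (1 + t)\<^sup>2 + (b * (1 - t) - a * (1 + t))\<^sup>2)"
      using nz unfolding m_def m'_def by (simp add: divide_simps)
    moreover have "4 * (N / ((1 - t) * (1 + t))) * ((1 - t)\<^sup>2 * (1 + t)\<^sup>2) = 4 * N * ((1 - t) * (1 + t))"
      using nz by (simp add: divide_simps) algebra
    moreover have "4 * jacobi_F \<alpha> \<beta> n t * ((1 - t)\<^sup>2 * (1 + t)\<^sup>2) =
      - jacobi_z \<alpha> \<beta> n * t\<^sup>2 - 2 * ((\<alpha>\<^sup>2 - 1) - (\<beta>\<^sup>2 - 1)) * t - 2 * (\<alpha>\<^sup>2 - 1) - 2 * (\<beta>\<^sup>2 - 1) + jacobi_z \<alpha> \<beta> n"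
      using nz unfolding jacobi_F_def Let_def D by simp
    moreover have "4 * (- b * (1 - t)\<^sup>2 - a * (1 + t)\<^sup>2 + (b * (1 - t) - a * (1 + t))\<^sup>2) =
      4 * N * ((1 - t) * (1 + t)) - 
      (- jacobi_z \<alpha> \<beta> n * t\<^sup>2 - 2 * ((\<alpha>\<^sup>2 - 1) - (\<beta>\<^sup>2 - 1)) * t - 2 * (\<alpha>\<^sup>2 - 1) - 2 * (\<beta>\<^sup>2 - 1) + jacobi_z \<alpha> \<beta> n)"
      unfolding a_def b_def N_def jacobi_z_def by (simp add: field_simps power2_eq_square)
    ultimately have "(m' + m\<^sup>2) * ((1 - t)\<^sup>2 * (1 + t)\<^sup>2) =
        (N / ((1 - t) * (1 + t)) - jacobi_F \<alpha> \<beta> n t) * ((1 - t)\<^sup>2 * (1 + t)\<^sup>2)"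
      unfolding left_diff_distrib by linarith
    then show ?thesis using nz by simp
  qed
  also have "W * (- (N / ((1 - t) * (1 + t))) * P + (N / ((1 - t) * (1 + t)) - jacobi_F \<alpha> \<beta> n t) * P) =
      - (jacobi_F \<alpha> \<beta> n t * jacobi_nf \<alpha> \<beta> n t)"
    unfolding jacobi_nf_def W_def P_def by (simp add: algebra_simps)
  finally show ?thesis .
qed

lemma consecutive_zeros_jacobi_nf:
  "consecutive_zeros (jacobi_nf \<alpha> \<beta> n) = consecutive_zeros (poly (jacobi_poly \<alpha> \<beta> n))"
  by (simp add: fun_eq_iff consecutive_zeros_def jacobi_nf_def jacobi_weight_def)

lemma cube_neg:
  fixes t :: real
  assumes "t \<in> {-1<..<1}"
  shows "2 * (t\<^sup>2 - 1) ^ 3 < 0"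
  using assms abs_square_less_1[of t] by auto

section \<open>Convexity of the zeros of Jacobi polynomials\<close>

lemma jacobi_zeros_convex_on:
  assumes "-1 \<le> a" "b \<le> 1" "\<And>t. a < t \<Longrightarrow> t < b \<Longrightarrow> 0 < jacobi_j \<alpha> \<beta> n t"
  shows "zeros_convex_on (poly (jacobi_poly \<alpha> \<beta> n)) a b"
proof -
  have "zeros_convex_on (jacobi_nf \<alpha> \<beta> n) a b"
  proof (rule zeros_convex_on_if_decreasing)
    fix s t assume st: "a < s" "s < t" "t < b"
    show "jacobi_F \<alpha> \<beta> n t < jacobi_F \<alpha> \<beta> n s"
    proof (rule DERIV_neg_imp_decreasing[OF st(2)])
      fix r assume "s \<le> r" "r \<le> t"
      then have r: "r \<in> {-1<..<1}" "0 < jacobi_j \<alpha> \<beta> n r" using st assms by auto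
      show "\<exists>d. (jacobi_F \<alpha> \<beta> n has_real_derivative d) (at r) \<and> d < 0"
        using jacobi_F_deriv[OF r(1), of \<alpha> \<beta> n] divide_pos_neg[OF r(2) cube_neg[OF r(1)]] by blast
    qed
  qed (use assms in \<open>auto intro: jacobi_nf_deriv jacobi_nf'_deriv\<close>)
  then show ?thesis unfolding zeros_convex_on_def consecutive_zeros_jacobi_nf .
qed

lemma jacobi_zeros_concave_on:
  assumes "-1 \<le> a" "b \<le> 1" "\<And>t. a < t \<Longrightarrow> t < b \<Longrightarrow> jacobi_j \<alpha> \<beta> n t < 0"
  shows "zeros_concave_on (poly (jacobi_poly \<alpha> \<beta> n)) a b"
proof -
  have "zeros_concave_on (jacobi_nf \<alpha> \<beta> n) a b"
  proof (rule zeros_concave_on_if_increasing)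
    fix s t assume st: "a < s" "s < t" "t < b"
    show "jacobi_F \<alpha> \<beta> n s < jacobi_F \<alpha> \<beta> n t"
    proof (rule DERIV_pos_imp_increasing[OF st(2)])
      fix r assume "s \<le> r" "r \<le> t"
      then have r: "r \<in> {-1<..<1}" "jacobi_j \<alpha> \<beta> n r < 0" using st assms by auto
      show "\<exists>d. (jacobi_F \<alpha> \<beta> n has_real_derivative d) (at r) \<and> 0 < d"
        using jacobi_F_deriv[OF r(1), of \<alpha> \<beta> n] divide_neg_neg[OF r(2) cube_neg[OF r(1)]] by blast
    qed
  qed (use assms in \<open>auto intro: jacobi_nf_deriv jacobi_nf'_deriv\<close>)
  then show ?thesis unfolding zeros_concave_on_def consecutive_zeros_jacobi_nf .
qed

lemma eventually_jacobi_z_gt: "\<forall>\<^sub>F n in sequentially. K < jacobi_z \<alpha> \<beta> n"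
proof -
  have "filterlim (\<lambda>n. real n) at_top sequentially" by (rule filterlim_real_sequentially)
  then have "\<forall>\<^sub>F n in sequentially. \<bar>\<alpha> + \<beta>\<bar> + \<bar>K\<bar> + 1 \<le> real n"
    by (simp add: filterlim_at_top)
  then show ?thesis
  proof eventually_elim
    case (elim n)
    have "\<bar>K\<bar> + 1 \<le> \<alpha> + \<beta> + 2 * real n" using elim by argo
    then have "(\<bar>K\<bar> + 1) * 1 \<le> jacobi_z \<alpha> \<beta> n"
      unfolding jacobi_z_def by (intro mult_mono) auto
    then show ?case by argo
  qed
qed

theorem theorem4p2:
  fixes \<alpha> \<beta> :: real
  shows "\<forall>\<^sub>F n in sequentially.
    (\<bar>\<alpha>\<bar> \<le> 1 \<and> \<bar>\<beta>\<bar> \<le> 1 \<longrightarrow>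
      (\<exists>r. jacobi_j_zeros \<alpha> \<beta> n = {r} \<and>
        zeros_convex_on (poly (jacobi_poly \<alpha> \<beta> n)) (-1) r \<and>
        zeros_concave_on (poly (jacobi_poly \<alpha> \<beta> n)) r 1)) \<and>
    (\<bar>\<alpha>\<bar> \<le> 1 \<and> \<bar>\<beta>\<bar> > 1 \<longrightarrow>
      (\<exists>r\<^sub>1 r\<^sub>2. r\<^sub>1 < r\<^sub>2 \<and> jacobi_j_zeros \<alpha> \<beta> n = {r\<^sub>1, r\<^sub>2} \<and>
        zeros_concave_on (poly (jacobi_poly \<alpha> \<beta> n)) (-1) r\<^sub>1 \<and>
        zeros_convex_on (poly (jacobi_poly \<alpha> \<beta> n)) r\<^sub>1 r\<^sub>2 \<and>
        zeros_concave_on (poly (jacobi_poly \<alpha> \<beta> n)) r\<^sub>2 1)) \<and>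
    (\<bar>\<alpha>\<bar> > 1 \<and> \<bar>\<beta>\<bar> \<le> 1 \<longrightarrow>
      (\<exists>r\<^sub>1 r\<^sub>2. r\<^sub>1 < r\<^sub>2 \<and> jacobi_j_zeros \<alpha> \<beta> n = {r\<^sub>1, r\<^sub>2} \<and>
        zeros_convex_on (poly (jacobi_poly \<alpha> \<beta> n)) (-1) r\<^sub>1 \<and>
        zeros_concave_on (poly (jacobi_poly \<alpha> \<beta> n)) r\<^sub>1 r\<^sub>2 \<and>
        zeros_convex_on (poly (jacobi_poly \<alpha> \<beta> n)) r\<^sub>2 1)) \<and>
    (\<bar>\<alpha>\<bar> > 1 \<and> \<bar>\<beta>\<bar> > 1 \<longrightarrow>
      (\<exists>r\<^sub>1 r\<^sub>2 r\<^sub>3. r\<^sub>1 < r\<^sub>2 \<and> r\<^sub>2 < r\<^sub>3 \<and> jacobi_j_zeros \<alpha> \<beta> n = {r\<^sub>1, r\<^sub>2, r\<^sub>3} \<and>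
        zeros_concave_on (poly (jacobi_poly \<alpha> \<beta> n)) (-1) r\<^sub>1 \<and>
        zeros_convex_on (poly (jacobi_poly \<alpha> \<beta> n)) r\<^sub>1 r\<^sub>2 \<and>
        zeros_concave_on (poly (jacobi_poly \<alpha> \<beta> n)) r\<^sub>2 r\<^sub>3 \<and>
        zeros_convex_on (poly (jacobi_poly \<alpha> \<beta> n)) r\<^sub>3 1))"
  using eventually_jacobi_z_gt[of "40 * (\<bar>\<alpha>\<^sup>2 - 1\<bar> + \<bar>\<beta>\<^sup>2 - 1\<bar>) + 40" \<alpha> \<beta>]
proof eventually_elim
  case (elim n)
  define x where "x = \<alpha>\<^sup>2 - 1"
  define y where "y = \<beta>\<^sup>2 - 1"
  define z where "z = jacobi_z \<alpha> \<beta> n"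
  define j where "j = jacobi_j \<alpha> \<beta> n"
  have z: "40 * (\<bar>x\<bar> + \<bar>y\<bar>) + 40 < z" using elim by (simp add: x_def y_def z_def)
  have j: "jcubic x y z = j" by (simp add: jacobi_j_eq_jcubic x_def y_def z_def j_def)
  have x: "x \<le> 0 \<longleftrightarrow> \<bar>\<alpha>\<bar> \<le> 1" and y: "y \<le> 0 \<longleftrightarrow> \<bar>\<beta>\<bar> \<le> 1"
    by (simp_all add: x_def y_def abs_square_le_1)
  obtain q where q: "-1/2 < q" "q < 1/2" "j q = 0"
    "\<And>t. -1/2 \<le> t \<Longrightarrow> t < q \<Longrightarrow> 0 < j t" "\<And>t. q < t \<Longrightarrow> t \<le> 1/2 \<Longrightarrow> j t < 0"
    using jcubic_middle[OF z] unfolding j by metis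

  define C where "C = zeros_convex_on (poly (jacobi_poly \<alpha> \<beta> n))"
  define D where "D = zeros_concave_on (poly (jacobi_poly \<alpha> \<beta> n))"
  note convex = jacobi_zeros_convex_on[where \<alpha> = \<alpha> and \<beta> = \<beta> and n = n, folded j_def C_def]
  note concave = jacobi_zeros_concave_on[where \<alpha> = \<alpha> and \<beta> = \<beta> and n = n, folded j_def D_def]
  have q1: "-1 < q" "q < 1" using q by auto
  \<comment> \<open>The zero \<open>q\<close> exists in all four cases. Whether \<open>j\<close> has a further zero to its
    left depends only on whether \<open>\<bar>\<beta>\<bar> > 1\<close>, and to its right only on whether \<open>\<bar>\<alpha>\<bar> > 1\<close>; the two
    alternatives on each side give the four cases.\<close>
  define Zl where "Zl = {t. -1 < t \<and> t < q \<and> j t = 0}"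
  define Zr where "Zr = {t. q < t \<and> t < 1 \<and> j t = 0}"
  have zeros: "jacobi_j_zeros \<alpha> \<beta> n = Zl \<union> {q} \<union> Zr"
    using q1 q(3) by (auto simp: jacobi_j_zeros_def Zl_def Zr_def j_def)

  have left_nonpos: "Zl = {} \<and> C (-1) q" if y0: "y \<le> 0"
  proof
    have pos: "0 < j t" if "-1 < t" "t < q" for t
      using jcubic_left_nonpos[OF z y0, of t] q(4)[of t] that unfolding j
      by (cases "t \<le> -1/2") auto
    show "Zl = {}"
      using pos unfolding Zl_def by (metis (mono_tags, lifting) Collect_empty_eq less_irrefl)
    show "C (-1) q"
      using q1 by (intro convex pos) auto
  qed
  have right_nonpos: "Zr = {} \<and> D q 1" if x0: "x \<le> 0"
  proof
    have neg: "j t < 0" if "q < t" "t < 1" for t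
      using jcubic_right_nonpos[OF z x0, of t] q(5)[of t] that unfolding j
      by (cases "t \<le> 1/2") auto
    show "Zr = {}"
      using neg unfolding Zr_def by (metis (mono_tags, lifting) Collect_empty_eq less_irrefl)
    show "D q 1"
      using q1 by (intro concave neg) auto
  qed
  have left_pos: "\<exists>p. p < q \<and> Zl = {p} \<and> D (-1) p \<and> C p q" if y0: "0 < y"
  proof -
    obtain p where p: "-1 < p" "p < -1/2" "j p = 0"
      and neg: "\<And>t. -1 < t \<Longrightarrow> t < p \<Longrightarrow> j t < 0"
      and pos: "\<And>t. p < t \<Longrightarrow> t \<le> -1/2 \<Longrightarrow> 0 < j t"
      using jcubic_left_pos[OF z y0] unfolding j by metis
    have pos': "0 < j t" if "p < t" "t < q" for t
      using pos[of t] q(4)[of t] that by (cases "t \<le> -1/2") auto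
    have pq: "p < q" using p q(1) by simp
    have "t = p" if "t \<in> Zl" for t
      using neg[of t] pos'[of t] that unfolding Zl_def by (cases t p rule: linorder_cases) auto
    moreover have "p \<in> Zl" using p(1,3) pq by (simp add: Zl_def)
    ultimately have "Zl = {p}" by blast
    moreover have "D (-1) p" using pq q1 by (intro concave neg) auto
    moreover have "C p q" using p(1) q1 by (intro convex pos') auto
    ultimately show ?thesis using pq by blast
  qed
  have right_pos: "\<exists>r. q < r \<and> Zr = {r} \<and> D q r \<and> C r 1" if x0: "0 < x"
  proof -
    obtain r where r: "1/2 < r" "r < 1" "j r = 0"
      and neg: "\<And>t. 1/2 \<le> t \<Longrightarrow> t < r \<Longrightarrow> j t < 0"
      and pos: "\<And>t. r < t \<Longrightarrow> t < 1 \<Longrightarrow> 0 < j t"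
      using jcubic_right_pos[OF z x0] unfolding j by metis
    have neg': "j t < 0" if "q < t" "t < r" for t
      using neg[of t] q(5)[of t] that by (cases "t \<le> 1/2") auto
    have qr: "q < r" using r q(2) by simp
    have "t = r" if "t \<in> Zr" for t
      using neg'[of t] pos[of t] that unfolding Zr_def by (cases t r rule: linorder_cases) auto
    moreover have "r \<in> Zr" using r(2,3) qr by (simp add: Zr_def)
    ultimately have "Zr = {r}" by blast
    moreover have "D q r" using r(2) q1 by (intro concave neg') auto
    moreover have "C r 1" using qr q1 by (intro convex pos) auto
    ultimately show ?thesis using qr by blast
  qed

  show ?case
    unfolding zeros C_def[symmetric] D_def[symmetric]
  proof (intro conjI impI)
    assume "\<bar>\<alpha>\<bar> \<le> 1 \<and> \<bar>\<beta>\<bar> \<le> 1"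
    then have "x \<le> 0" "y \<le> 0" using x y by auto
    with left_nonpos right_nonpos
    show "\<exists>r. Zl \<union> {q} \<union> Zr = {r} \<and> C (-1) r \<and> D r 1"
      by (intro exI[of _ q]) auto
  next
    assume "\<bar>\<alpha>\<bar> \<le> 1 \<and> \<bar>\<beta>\<bar> > 1"
    then have xy: "x \<le> 0" "0 < y" using x y by auto
    obtain p where "p < q" "Zl = {p}" "D (-1) p" "C p q"
      using left_pos[OF xy(2)] by blast
    with right_nonpos[OF xy(1)]
    show "\<exists>r\<^sub>1 r\<^sub>2. r\<^sub>1 < r\<^sub>2 \<and> Zl \<union> {q} \<union> Zr = {r\<^sub>1, r\<^sub>2} \<and> D (-1) r\<^sub>1 \<and> C r\<^sub>1 r\<^sub>2 \<and> D r\<^sub>2 1"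
      by (intro exI[of _ p] exI[of _ q]) auto
  next
    assume "\<bar>\<alpha>\<bar> > 1 \<and> \<bar>\<beta>\<bar> \<le> 1"
    then have xy: "0 < x" "y \<le> 0" using x y by auto
    obtain r where "q < r" "Zr = {r}" "D q r" "C r 1"
      using right_pos[OF xy(1)] by blast
    with left_nonpos[OF xy(2)]
    show "\<exists>r\<^sub>1 r\<^sub>2. r\<^sub>1 < r\<^sub>2 \<and> Zl \<union> {q} \<union> Zr = {r\<^sub>1, r\<^sub>2} \<and> C (-1) r\<^sub>1 \<and> D r\<^sub>1 r\<^sub>2 \<and> C r\<^sub>2 1"
      by (intro exI[of _ q] exI[of _ r]) auto
  next
    assume "\<bar>\<alpha>\<bar> > 1 \<and> \<bar>\<beta>\<bar> > 1"
    then have xy: "0 < x" "0 < y" using x y by auto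
    obtain p where "p < q" "Zl = {p}" "D (-1) p" "C p q"
      using left_pos[OF xy(2)] by blast
    moreover obtain r where "q < r" "Zr = {r}" "D q r" "C r 1"
      using right_pos[OF xy(1)] by blast
    ultimately
    show "\<exists>r\<^sub>1 r\<^sub>2 r\<^sub>3. r\<^sub>1 < r\<^sub>2 \<and> r\<^sub>2 < r\<^sub>3 \<and> Zl \<union> {q} \<union> Zr = {r\<^sub>1, r\<^sub>2, r\<^sub>3} \<and>
        D (-1) r\<^sub>1 \<and> C r\<^sub>1 r\<^sub>2 \<and> D r\<^sub>2 r\<^sub>3 \<and> C r\<^sub>3 1"
      by (intro exI[of _ p] exI[of _ q] exI[of _ r]) auto
  qed
qed

end
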